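(* Let $\Sigma=(A,G,\alpha,\sigma)$ be a twisted unital discrete C$^*$-dynamical system having property (DP). Then the map $\varphi\mapsto\varphi\circ E$ is a bijection between the set of invariant tracial states of $A$ and the set of tracial states of $C_r^*(\Sigma)$. Especially, $C_r^*(\Sigma)$ has a unique tracial state if and only if $A$ has a unique invariant tracial state.
   Context: A twisted unital discrete C$^*$-dynamical system $\Sigma=(A,G,\alpha,\sigma)$ consists of a unital C$^*$-algebra $A$, a discrete group $G$ with identity $e$, and maps $\alpha:G\to\mathrm{Aut}(A)$, $\sigma:G\times G\to\mathcal{U}(A)$ (the unitary group of $A$) such that for all $g,h,k\in G$: $\alpha_g\circ\alpha_h=\mathrm{Ad}(\sigma(g,h))\circ\alpha_{gh}$, $\sigma(g,h)\sigma(gh,k)=\alpha_g(\sigma(h,k))\sigma(g,hk)$, $\sigma(g,e)=\sigma(e,g)=1$. The reduced crossed product $C_r^*(\Sigma)$ is characterized up to isomorphism as follows: it is a C$^*$-algebra generated by (a copy of) $A$ and unitaries $\{\lambda(g)\mid g\in G\}$ with $\alpha_g(a)=\lambda(g)a\lambda(g)^*$ and $\lambda(g)\lambda(h)=\sigma(g,h)\lambda(gh)$ for all $g,h\in G$, $a\in A$, and there is a faithful conditional expectation $E:C_r^*(\Sigma)\to A$ with $E(\lambda(g))=0$ for all $g\ne e$. Property (DP): $\Sigma$ has property (DP) if for every $y\in C_r^*(\Sigma)$ with $y^*=y$ and $E(y)=0$, the element $0$ belongs to the norm closure of the convex hull of $\{vyv^*\mid v\in\mathcal{U}(C_r^*(\Sigma))\}$.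 A tracial state $\varphi$ of $A$ is invariant if $\varphi(\alpha_g(a))=\varphi(a)$ for all $g\in G$, $a\in A$. *)

theory Defs
  imports "HOL-Analysis.Analysis" "HOL-Algebra.Group"
begin

(* Unital C*-algebras are types. Through real_normed_algebra_1 they are nonzero and the norm of 1
   is 1; the class adds complex scalars, extending the real ones,
   and the involution with the C*-identity. *)

class unital_cstar_algebra = real_normed_algebra_1 + banach +
  fixes scaleC :: "complex \<Rightarrow> 'a \<Rightarrow> 'a"  (infixr "*\<^sub>C" 75)
    and star :: "'a \<Rightarrow> 'a"
  assumes scaleC_add_right: "c *\<^sub>C (x + y) = c *\<^sub>C x + c *\<^sub>C y"
    and scaleC_add_left: "(c + d) *\<^sub>C x = c *\<^sub>C x + d *\<^sub>C x"
    and scaleC_scaleC: "c *\<^sub>C (d *\<^sub>C x) = (c * d) *\<^sub>C x"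
    and scaleC_of_real: "complex_of_real r *\<^sub>C x = r *\<^sub>R x"
    and mult_scaleC_left: "(c *\<^sub>C x) * y = c *\<^sub>C (x * y)"
    and mult_scaleC_right: "x * (c *\<^sub>C y) = c *\<^sub>C (x * y)"
    and norm_scaleC: "norm (c *\<^sub>C x) = cmod c * norm x"
    and star_star: "star (star x) = x"
    and star_add: "star (x + y) = star x + star y"
    and star_scaleC: "star (c *\<^sub>C x) = cnj c *\<^sub>C star x"
    and star_mult: "star (x * y) = star y * star x"
    and norm_star_mult: "norm (star x * x) = (norm x)\<^sup>2"

instantiation complex :: unital_cstar_algebra
begin

definition scaleC_complex :: "complex \<Rightarrow> complex \<Rightarrow> complex"
  where "scaleC_complex c z = c * z"

definition star_complex :: "complex \<Rightarrow> complex"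
  where "star_complex z = cnj z"

instance
  by standard
    (simp_all add: scaleC_complex_def star_complex_def algebra_simps scaleR_conv_of_real
      norm_mult power2_eq_square)

end

definition clinear :: "('a::unital_cstar_algebra \<Rightarrow> 'b::unital_cstar_algebra) \<Rightarrow> bool"
  where "clinear f \<longleftrightarrow>
    (\<forall>x y. f (x + y) = f x + f y) \<and> (\<forall>c x. f (c *\<^sub>C x) = c *\<^sub>C f x)"

definition star_hom :: "('a::unital_cstar_algebra \<Rightarrow> 'b::unital_cstar_algebra) \<Rightarrow> bool"
  where "star_hom f \<longleftrightarrow> clinear f \<and> f 1 = 1 \<and>
    (\<forall>x y. f (x * y) = f x * f y) \<and> (\<forall>x. f (star x) = star (f x))"

definition star_aut :: "('a::unital_cstar_algebra \<Rightarrow> 'a) \<Rightarrow> bool"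
  where "star_aut f \<longleftrightarrow> star_hom f \<and> bij f"

definition unitaries :: "'a::unital_cstar_algebra set"
  where "unitaries = {u. star u * u = 1 \<and> u * star u = 1}"

definition positive_elem :: "'a::unital_cstar_algebra \<Rightarrow> bool"
  where "positive_elem a \<longleftrightarrow> (\<exists>b. a = star b * b)"

definition cstar_subalgebra :: "'a::unital_cstar_algebra set \<Rightarrow> bool"
  where "cstar_subalgebra C \<longleftrightarrow> closed C \<and> 0 \<in> C \<and>
    (\<forall>x\<in>C. \<forall>y\<in>C. x + y \<in> C \<and> x * y \<in> C) \<and>
    (\<forall>c. \<forall>x\<in>C. c *\<^sub>C x \<in> C) \<and> (\<forall>x\<in>C. star x \<in> C)"

(* States are positive linear functionals of norm one. Boundedness is listed because the
   supremum defining onorm is only meaningful for bounded maps. *)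

definition state :: "('a::unital_cstar_algebra \<Rightarrow> complex) \<Rightarrow> bool"
  where "state \<phi> \<longleftrightarrow> clinear \<phi> \<and> (\<forall>x. positive_elem x \<longrightarrow> \<phi> x \<in> \<real>\<^sub>\<ge>\<^sub>0) \<and>
    bounded_linear \<phi> \<and> onorm \<phi> = 1"

definition tracial_state :: "('a::unital_cstar_algebra \<Rightarrow> complex) \<Rightarrow> bool"
  where "tracial_state \<phi> \<longleftrightarrow> state \<phi> \<and> (\<forall>x y. \<phi> (x * y) = \<phi> (y * x))"

(* A conditional expectation onto the copy of A inside B given by an embedding \<iota> of A into B,
   with values read in A rather than in the range of \<iota>: the projection in the usual
   sense is \<iota> o E. *)

definition conditional_expectation ::
    "('a::unital_cstar_algebra \<Rightarrow> 'b::unital_cstar_algebra) \<Rightarrow> ('b \<Rightarrow> 'a) \<Rightarrow> bool"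
  where "conditional_expectation \<iota> E \<longleftrightarrow> clinear E \<and>
    (\<forall>a. E (\<iota> a) = a) \<and>
    (\<forall>x. norm (E x) \<le> norm x) \<and>
    (\<forall>x. positive_elem x \<longrightarrow> positive_elem (E x)) \<and>
    (\<forall>a x b. E (\<iota> a * x * \<iota> b) = a * E x * b)"

definition faithful_map :: "('b::unital_cstar_algebra \<Rightarrow> 'a::unital_cstar_algebra) \<Rightarrow> bool"
  where "faithful_map E \<longleftrightarrow> (\<forall>x. positive_elem x \<and> E x = 0 \<longrightarrow> x = 0)"

locale twisted_system = group G for G (structure) +
  fixes \<alpha> :: "'g \<Rightarrow> 'a::unital_cstar_algebra \<Rightarrow> 'a"
    and \<sigma> :: "'g \<Rightarrow> 'g \<Rightarrow> 'a"
  assumes aut: "g \<in> carrier G \<Longrightarrow> star_aut (\<alpha> g)"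
    and unitary_cocycle: "\<lbrakk>g \<in> carrier G; h \<in> carrier G\<rbrakk> \<Longrightarrow> \<sigma> g h \<in> unitaries"
    and twisted_action: "\<lbrakk>g \<in> carrier G; h \<in> carrier G\<rbrakk> \<Longrightarrow>
      \<alpha> g (\<alpha> h a) = \<sigma> g h * \<alpha> (g \<otimes> h) a * star (\<sigma> g h)"
    and cocycle: "\<lbrakk>g \<in> carrier G; h \<in> carrier G; k \<in> carrier G\<rbrakk> \<Longrightarrow>
      \<sigma> g h * \<sigma> (g \<otimes> h) k = \<alpha> g (\<sigma> h k) * \<sigma> g (h \<otimes> k)"
    and normalized: "g \<in> carrier G \<Longrightarrow> \<sigma> g \<one> = 1" "g \<in> carrier G \<Longrightarrow> \<sigma> \<one> g = 1"

(* The reduced crossed product is given by its characterization up to isomorphism: the type 'b,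
   together with the embedding \<iota> of A, the canonical unitaries lam and the faithful
   conditional expectation E, is a model of it. *)

locale reduced_crossed_product = twisted_system G \<alpha> \<sigma>
  for G :: "('g, 'm) monoid_scheme" (structure)
    and \<alpha> :: "'g \<Rightarrow> 'a::unital_cstar_algebra \<Rightarrow> 'a"
    and \<sigma> :: "'g \<Rightarrow> 'g \<Rightarrow> 'a" +
  fixes \<iota> :: "'a \<Rightarrow> 'b::unital_cstar_algebra"
    and lam :: "'g \<Rightarrow> 'b"
    and E :: "'b \<Rightarrow> 'a"
  assumes embedding: "star_hom \<iota>" "norm (\<iota> a) = norm a"
    and lam_unitary: "g \<in> carrier G \<Longrightarrow> lam g \<in> unitaries"
    and covariant: "g \<in> carrier G \<Longrightarrow> \<iota> (\<alpha> g a) = lam g * \<iota> a * star (lam g)"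
    and lam_mult: "\<lbrakk>g \<in> carrier G; h \<in> carrier G\<rbrakk> \<Longrightarrow>
      lam g * lam h = \<iota> (\<sigma> g h) * lam (g \<otimes> h)"
    and generated: "cstar_subalgebra hull (range \<iota> \<union> lam ` carrier G) = UNIV"
    and expectation: "conditional_expectation \<iota> E"
    and faithful: "faithful_map E"
    and expectation_lam: "\<lbrakk>g \<in> carrier G; g \<noteq> \<one>\<rbrakk> \<Longrightarrow> E (lam g) = 0"

definition property_DP :: "('b::unital_cstar_algebra \<Rightarrow> 'a::unital_cstar_algebra) \<Rightarrow> bool"
  where "property_DP E \<longleftrightarrow>
    (\<forall>y. star y = y \<and> E y = 0 \<longrightarrow> 0 \<in> closure (convex hull {v * y * star v | v. v \<in> unitaries}))"

definition invariant_tracial_state ::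
    "('g, 'm) monoid_scheme \<Rightarrow> ('g \<Rightarrow> 'a::unital_cstar_algebra \<Rightarrow> 'a) \<Rightarrow> ('a \<Rightarrow> complex) \<Rightarrow> bool"
  where "invariant_tracial_state G \<alpha> \<phi> \<longleftrightarrow>
    tracial_state \<phi> \<and> (\<forall>g\<in>carrier G. \<forall>a. \<phi> (\<alpha> g a) = \<phi> a)"

end

theory Submission
  imports Defs
begin

text \<open>
  Monomials \<open>\<iota> a * lam g\<close> have dense span, so continuous functionals can be compared on
  them. For an invariant tracial state, the relation \<open>\<alpha> g (\<sigma> g\<inverse> g) = \<sigma> g g\<inverse>\<close> makes
  \<open>\<phi> \<circ> E\<close> tracial on monomials. Conversely, a tracial state \<open>\<psi>\<close> is constant on the closed convex hull
  of a unitary orbit, so (DP) makes it vanish on \<open>x - \<iota> (E x)\<close> for selfadjoint \<open>x\<close>, and hence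
  \<open>\<psi> = (\<psi> \<circ> \<iota>) \<circ> E\<close>.
\<close>

section \<open>Unital C*-algebras\<close>

lemma star_one [simp]: "star (1 :: 'a::unital_cstar_algebra) = 1"
  by (metis mult.left_neutral mult.right_neutral star_mult star_star)

lemma star_scaleR: "star (r *\<^sub>R x) = r *\<^sub>R star (x :: 'a::unital_cstar_algebra)"
  by (metis complex_cnj_complex_of_real scaleC_of_real star_scaleC)

lemma linear_star: "linear (star :: 'a::unital_cstar_algebra \<Rightarrow> 'a)"
  by (intro linearI star_add star_scaleR)

lemma star_diff: "star (x - y) = star x - star (y :: 'a::unital_cstar_algebra)"
  by (rule linear_diff[OF linear_star])

text \<open>The C*-identity and submultiplicativity bound the square of \<open>norm x\<close> by
  \<open>norm (star x) * norm x\<close>; one factor cancels.\<close>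

lemma norm_le_norm_star: "norm (x :: 'a::unital_cstar_algebra) \<le> norm (star x)"
proof (cases "x = 0")
  case False
  have "norm x * norm x \<le> norm (star x) * norm x"
    using norm_mult_ineq[of "star x" x] by (simp add: norm_star_mult power2_eq_square)
  then show ?thesis
    using False by simp
qed simp

lemma norm_star [simp]: "norm (star x) = norm (x :: 'a::unital_cstar_algebra)"
  using norm_le_norm_star[of x] norm_le_norm_star[of "star x"] by (simp add: star_star)

lemma bounded_linear_star: "bounded_linear (star :: 'a::unital_cstar_algebra \<Rightarrow> 'a)"
  by (rule bounded_linear_intro[where K = 1]) (simp_all add: star_add star_scaleR)

lemma bounded_linear_scaleC: "bounded_linear (\<lambda>x :: 'a::unital_cstar_algebra. c *\<^sub>C x)"
proof (rule bounded_linear_intro[where K = "cmod c"])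
  fix r and x :: 'a
  show "c *\<^sub>C (r *\<^sub>R x) = r *\<^sub>R (c *\<^sub>C x)"
    by (metis mult.commute scaleC_of_real scaleC_scaleC)
qed (simp_all add: scaleC_add_right norm_scaleC mult.commute)

lemma unitaries_star_mult: "u \<in> unitaries \<Longrightarrow> star u * u = 1"
  and unitaries_mult_star: "u \<in> unitaries \<Longrightarrow> u * star u = 1"
  by (simp_all add: unitaries_def)

lemma positive_elem_star: "positive_elem a \<Longrightarrow> star a = a"
  by (auto simp: positive_elem_def star_mult star_star)

section \<open>Complex-linear maps and reduction to selfadjoint elements\<close>

lemma clinear_add: "clinear f \<Longrightarrow> f (x + y) = f x + f y"
  and clinear_scaleC: "clinear f \<Longrightarrow> f (c *\<^sub>C x) = c *\<^sub>C f x"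
  by (simp_all add: clinear_def)

lemma clinear_linear: "clinear f \<Longrightarrow> linear f"
  by (rule linearI) (auto simp: clinear_add clinear_scaleC simp flip: scaleC_of_real)

lemma clinear_compose: "clinear f \<Longrightarrow> clinear g \<Longrightarrow> clinear (f \<circ> g)"
  by (simp add: clinear_def)

text \<open>Polarization against the unit. It writes a selfadjoint element as a difference of
  positive ones without functional calculus.\<close>

lemma selfadjoint_eq_diff_squares:
  fixes x :: "'a::unital_cstar_algebra"
  assumes "star x = x"
  shows "x = (1/4) *\<^sub>R (star (1 + x) * (1 + x) - star (1 - x) * (1 - x))"
proof -
  have "star (1 + x) * (1 + x) - star (1 - x) * (1 - x) = x + x + x + x"
    by (simp add: star_add star_diff assms algebra_simps)
  also have "\<dots> = 4 *\<^sub>R x"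
    by (metis (no_types) add.assoc numeral_Bit0 scaleR_left.add scaleR_one one_add_one)
  finally show ?thesis
    by simp
qed

lemma selfadjoint_decomposition:
  fixes x :: "'a::unital_cstar_algebra"
  obtains h k where "star h = h" "star k = k" "x = h + \<i> *\<^sub>C k"
proof
  let ?h = "(1/2) *\<^sub>C (x + star x)" and ?k = "(- \<i>/2) *\<^sub>C (x - star x)"
  \<comment> \<open>\<open>star\<close> turns the factor \<open>- \<i>/2\<close> of
    \<open>?k\<close> into \<open>\<i>/2\<close> and reverses the difference; this identity moves
    the sign between scalar and vector.\<close>
  have neg: "- c *\<^sub>C y = c *\<^sub>C (- y)" for c and y :: 'a
    using scaleC_of_real[of "-1" y] scaleC_scaleC[of c "-1" y] by simp
  show "star ?h = ?h"
    by (simp add: star_scaleC star_add star_star add.commute)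
  show "star ?k = ?k"
    using neg[of "\<i>/2" "x - star x"] by (simp add: star_scaleC star_diff star_star)
  have "?h + \<i> *\<^sub>C ?k = (1/2) *\<^sub>C (x + star x) + (1/2) *\<^sub>C (x - star x)"
    by (simp add: scaleC_scaleC)
  also have "\<dots> = (1/2) *\<^sub>C (x + x)"
    by (simp flip: scaleC_add_right)
  also have "\<dots> = complex_of_real (1/2) *\<^sub>C (x + x)"
    by simp
  also have "\<dots> = x"
    unfolding scaleC_of_real by (simp flip: scaleR_2)
  finally show "x = ?h + \<i> *\<^sub>C ?k" ..
qed

text \<open>A positive map sends each \<open>star b * b\<close> to a selfadjoint element, hence by
  polarization selfadjoint elements to selfadjoint ones; real and imaginary parts give the rest.
  This is what makes \<open>E\<close> preserve adjoints.\<close>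

lemma positive_map_star:
  assumes f: "clinear f"
    and pos: "\<And>x. positive_elem x \<Longrightarrow> positive_elem (f x)"
  shows "f (star x) = star (f x)"
proof -
  have sa: "star (f h) = f h" if h: "star h = h" for h
  proof -
    have sq: "star (f (star b * b)) = f (star b * b)" for b
      by (rule positive_elem_star, rule pos) (auto simp: positive_elem_def)
    obtain p q where h_eq: "h = (1/4) *\<^sub>R (p - q)"
      and "star (f p) = f p" "star (f q) = f q"
      using selfadjoint_eq_diff_squares[OF h] sq by blast
    moreover have "f h = (1/4) *\<^sub>R (f p - f q)"
      unfolding h_eq
      by (simp only: linear_cmul[OF clinear_linear[OF f]] linear_diff[OF clinear_linear[OF f]])
    ultimately show ?thesis
      by (simp only: star_scaleR star_diff)
  qed
  obtain h k where "star h = h" "star k = k" "x = h + \<i> *\<^sub>C k"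
    by (rule selfadjoint_decomposition)
  then show ?thesis
    by (simp add: star_add star_scaleC clinear_add[OF f] clinear_scaleC[OF f] sa)
qed

lemma star_hom_positive: "star_hom f \<Longrightarrow> positive_elem x \<Longrightarrow> positive_elem (f x)"
  by (metis positive_elem_def star_hom_def)

section \<open>Closed linear spans\<close>

lemma subspace_closure:
  fixes S :: "'a::real_normed_vector set"
  assumes S: "subspace S"
  shows "subspace (closure S)"
proof (rule subspaceI)
  show "0 \<in> closure S"
    using subspace_0[OF S] closure_subset by blast
next
  fix x y assume "x \<in> closure S" "y \<in> closure S"
  then obtain u v where "\<And>n. u n \<in> S" "u \<longlonglongrightarrow> x" "\<And>n. v n \<in> S" "v \<longlonglongrightarrow> y"
    by (auto simp: closure_sequential)
  then have "\<forall>n. u n + v n \<in> S" "(\<lambda>n. u n + v n) \<longlonglongrightarrow> x + y"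
    by (simp_all add: subspace_add[OF S] tendsto_add)
  then show "x + y \<in> closure S"
    unfolding closure_sequential by (intro exI conjI)
next
  fix c x assume "x \<in> closure S"
  then obtain u where "\<And>n. u n \<in> S" "u \<longlonglongrightarrow> x"
    by (auto simp: closure_sequential)
  then have "\<forall>n. c *\<^sub>R u n \<in> S" "(\<lambda>n. c *\<^sub>R u n) \<longlonglongrightarrow> c *\<^sub>R x"
    by (simp_all add: subspace_scale[OF S] tendsto_scaleR)
  then show "c *\<^sub>R x \<in> closure S"
    unfolding closure_sequential by (intro exI conjI)
qed

text \<open>The preimage of a closed subspace is a closed subspace, so generators suffice. As spans
  are real, this also covers the conjugate-linear involution.\<close>

lemma bounded_linear_image_closure_span_subset:
  fixes f :: "'a::real_normed_vector \<Rightarrow> 'b::real_normed_vector"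
  assumes f: "bounded_linear f" and S: "f ` S \<subseteq> closure (span T)"
  shows "f ` closure (span S) \<subseteq> closure (span T)"
proof -
  have "subspace (f -` closure (span T))"
    by (intro linear_subspace_vimage bounded_linear.linear[OF f] subspace_closure subspace_span)
  then have "span S \<subseteq> f -` closure (span T)"
    using S by (intro span_minimal) auto
  moreover have "closed (f -` closure (span T))"
    by (intro closed_vimage closed_closure linear_continuous_on[OF f])
  ultimately show ?thesis
    using closure_minimal by blast
qed

lemma mult_mem_closure_span:
  fixes S :: "'a::real_normed_algebra set"
  assumes prod: "\<And>a b. a \<in> S \<Longrightarrow> b \<in> S \<Longrightarrow> a * b \<in> closure (span S)"
    and "x \<in> closure (span S)" "y \<in> closure (span S)"
  shows "x * y \<in> closure (span S)"
proof -
  let ?V = "closure (span S)"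
  \<comment> \<open>One factor at a time: first the left one ranges over the closed span against a
    generator \<open>b\<close>, then the right one with \<open>x\<close> fixed.\<close>
  have "(\<lambda>a. a * b) ` ?V \<subseteq> ?V" if "b \<in> S" for b
    using prod that
    by (intro bounded_linear_image_closure_span_subset bounded_linear_mult_left) auto
  then have "(\<lambda>b. x * b) ` ?V \<subseteq> ?V"
    using assms(2)
    by (intro bounded_linear_image_closure_span_subset bounded_linear_mult_right) auto
  then show ?thesis
    using assms(3) by blast
qed

section \<open>States and tracial states\<close>

lemma stateD:
  assumes "state \<phi>"
  shows "clinear \<phi>" "bounded_linear \<phi>" "positive_elem x \<Longrightarrow> \<phi> x \<in> \<real>\<^sub>\<ge>\<^sub>0"
    and "norm (\<phi> x) \<le> norm x"
  using assms onorm[of \<phi> x] by (auto simp: state_def)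

lemma tracial_state_comm: "tracial_state \<phi> \<Longrightarrow> \<phi> (x * y) = \<phi> (y * x)"
  by (simp add: tracial_state_def)

lemma tracial_state_unitary_conj:
  assumes "tracial_state \<phi>" "v \<in> unitaries"
  shows "\<phi> (v * y * star v) = \<phi> y"
  using tracial_state_comm[OF assms(1), of "v * y" "star v"]
  by (simp add: unitaries_star_mult[OF assms(2)] flip: mult.assoc)

text \<open>The section \<open>j\<close> forces the norm of \<open>\<phi> \<circ> f\<close> to be one, which avoids \<open>onorm \<phi> = norm (\<phi> 1)\<close>.\<close>

lemma state_compose:
  assumes \<phi>: "state \<phi>" and f: "clinear f"
    and pos: "\<And>x. positive_elem x \<Longrightarrow> positive_elem (f x)"
    and contr: "\<And>x. norm (f x) \<le> norm x"
    and section_j: "\<And>a. \<phi> (f (j a)) = \<phi> a" "\<And>a. norm (j a) \<le> norm a"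
  shows "state (\<phi> \<circ> f)"
proof -
  have lin: "clinear (\<phi> \<circ> f)"
    by (rule clinear_compose[OF stateD(1)[OF \<phi>] f])
  have le: "norm ((\<phi> \<circ> f) x) \<le> 1 * norm x" for x
    using stateD(4)[OF \<phi>, of "f x"] contr[of x] by simp
  have bl: "bounded_linear (\<phi> \<circ> f)"
    using le by (intro bounded_linear_intro[where K = 1])
      (simp_all only: linear_add[OF clinear_linear[OF lin]] linear_cmul[OF clinear_linear[OF lin]]
        mult.commute)
  have "onorm \<phi> \<le> onorm (\<phi> \<circ> f)"
  proof (rule onorm_le)
    fix a
    have "norm (\<phi> a) \<le> onorm (\<phi> \<circ> f) * norm (j a)"
      using onorm[OF bl, of "j a"] by (simp add: section_j)
    also have "\<dots> \<le> onorm (\<phi> \<circ> f) * norm a"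
      by (intro mult_left_mono section_j onorm_pos_le bl)
    finally show "norm (\<phi> a) \<le> onorm (\<phi> \<circ> f) * norm a" .
  qed
  moreover have "onorm (\<phi> \<circ> f) \<le> 1"
    by (rule onorm_le[OF le])
  ultimately have "onorm (\<phi> \<circ> f) = 1"
    using \<phi> by (simp add: state_def)
  then show ?thesis
    using lin bl pos stateD(3)[OF \<phi>] by (simp add: state_def)
qed

section \<open>The reduced crossed product\<close>

context reduced_crossed_product
begin

section \<open>Monomials and the density of their span\<close>

definition monomials :: "'b set"
  where "monomials = {\<iota> a * lam g | a g. g \<in> carrier G}"

lemma monomialsI: "g \<in> carrier G \<Longrightarrow> \<iota> a * lam g \<in> monomials"
  by (auto simp: monomials_def)

lemma embedding_clinear: "clinear \<iota>"
  and embedding_one: "\<iota> 1 = 1"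
  and embedding_mult: "\<iota> (a * b) = \<iota> a * \<iota> b"
  and embedding_star: "\<iota> (star a) = star (\<iota> a)"
  using embedding(1) by (auto simp: star_hom_def)

lemma expectation_clinear: "clinear E"
  and expectation_embedding: "E (\<iota> a) = a"
  and norm_expectation_le: "norm (E x) \<le> norm x"
  and expectation_positive: "positive_elem x \<Longrightarrow> positive_elem (E x)"
  and expectation_bimodule: "E (\<iota> a * x * \<iota> b) = a * E x * b"
  using expectation by (auto simp: conditional_expectation_def)

lemma expectation_left: "E (\<iota> a * x) = a * E x"
  using expectation_bimodule[of a x 1] by (simp add: embedding_one)

text \<open>Normalization makes \<open>lam \<one>\<close> idempotent, and an idempotent unitary is
  1.\<close>

lemma lam_one: "lam \<one> = 1"
proof -
  have "lam \<one> * lam \<one> = lam \<one>"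
    using lam_mult[of \<one> \<one>] by (simp add: normalized embedding_one)
  then have "star (lam \<one>) * lam \<one> * lam \<one> = star (lam \<one>) * lam \<one>"
    by (simp add: mult.assoc)
  then show ?thesis
    by (simp add: unitaries_star_mult[OF lam_unitary])
qed

lemma lam_embedding:
  assumes "g \<in> carrier G"
  shows "lam g * \<iota> a = \<iota> (\<alpha> g a) * lam g"
  by (simp add: covariant[OF assms] mult.assoc unitaries_star_mult[OF lam_unitary[OF assms]])

text \<open>Twisted convolution: covariance moves \<open>lam g\<close> past
  \<open>\<iota> b\<close>, and the cocycle appears when the two unitaries merge. So the span of the
  monomials is closed under products.\<close>

lemma monomial_mult:
  assumes "g \<in> carrier G" "h \<in> carrier G"
  shows "(\<iota> a * lam g) * (\<iota> b * lam h) = \<iota> (a * \<alpha> g b * \<sigma> g h) * lam (g \<otimes> h)"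
proof -
  have "(\<iota> a * lam g) * (\<iota> b * lam h) = \<iota> a * (lam g * \<iota> b) * lam h"
    by (simp only: mult.assoc)
  also have "\<dots> = \<iota> a * \<iota> (\<alpha> g b) * (lam g * lam h)"
    by (simp only: lam_embedding[OF assms(1)] mult.assoc)
  finally show ?thesis
    by (simp only: lam_mult[OF assms] embedding_mult mult.assoc)
qed

text \<open>\<open>lam (inv g) * lam g\<close> is the unitary
  \<open>\<iota> (\<sigma> (inv g) g)\<close>, so the right-hand side is a left inverse of the
  unitary \<open>lam g\<close>, hence its adjoint.\<close>

lemma star_lam:
  assumes g: "g \<in> carrier G"
  shows "star (lam g) = \<iota> (star (\<sigma> (inv g) g)) * lam (inv g)"
proof -
  have u: "star (\<sigma> (inv g) g) * \<sigma> (inv g) g = 1"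
    using g by (simp add: unitaries_star_mult unitary_cocycle)
  have "lam (inv g) * lam g = \<iota> (\<sigma> (inv g) g)"
    using lam_mult[of "inv g" g] g by (simp add: lam_one)
  then have "\<iota> (star (\<sigma> (inv g) g)) * (lam (inv g) * lam g) = 1"
    by (simp add: u embedding_one flip: embedding_mult)
  then have "\<iota> (star (\<sigma> (inv g) g)) * lam (inv g) * (lam g * star (lam g)) = star (lam g)"
    by (metis mult.assoc mult.left_neutral)
  then show ?thesis
    by (simp add: unitaries_mult_star[OF lam_unitary[OF g]])
qed

lemma star_monomial_mem:
  assumes "x \<in> monomials"
  shows "star x \<in> monomials"
proof -
  obtain a g where g: "g \<in> carrier G" and x: "x = \<iota> a * lam g"
    using assms by (auto simp: monomials_def)
  have "star x = \<iota> (star (\<sigma> (inv g) g)) * (lam (inv g) * \<iota> (star a))"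
    by (simp add: x star_mult star_lam[OF g] embedding_star mult.assoc)
  also have "\<dots> = \<iota> (star (\<sigma> (inv g) g) * \<alpha> (inv g) (star a)) * lam (inv g)"
    using g by (simp add: lam_embedding embedding_mult mult.assoc)
  finally show ?thesis
    using g by (simp add: monomialsI)
qed

text \<open>The closed span is itself a C*-subalgebra containing all generators, so minimality of
  the hull makes it everything.\<close>

lemma closure_span_monomials: "closure (span monomials) = UNIV"
proof -
  let ?V = "closure (span monomials)"
  have V: "subspace ?V"
    by (intro subspace_closure subspace_span)
  have sub: "monomials \<subseteq> ?V"
    by (meson closure_subset order_trans span_superset)
  have stable: "f x \<in> ?V" if "bounded_linear f" "f ` monomials \<subseteq> monomials" "x \<in> ?V" for f x
    using bounded_linear_image_closure_span_subset[OF that(1), of monomials monomials]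
      that(2,3) sub by blast
  have "cstar_subalgebra ?V"
    unfolding cstar_subalgebra_def
  proof (intro conjI ballI allI)
    fix x y assume xy: "x \<in> ?V" "y \<in> ?V"
    show "x + y \<in> ?V"
      using V xy by (simp add: subspace_add)
    have "a * b \<in> ?V" if "a \<in> monomials" "b \<in> monomials" for a b
      using that sub monomialsI by (auto simp: monomials_def monomial_mult intro!: subsetD[OF sub])
    then show "x * y \<in> ?V"
      using xy by (rule mult_mem_closure_span)
  next
    fix c x assume "x \<in> ?V"
    \<comment> \<open>\<open>span\<close> uses real scalars only; a complex scalar is absorbed into
      the coefficient \<open>a\<close>.\<close>
    moreover have "(*\<^sub>C) c ` monomials \<subseteq> monomials"
    proof (clarsimp simp: monomials_def)
      fix a g assume "g \<in> carrier G"
      moreover have "c *\<^sub>C (\<iota> a * lam g) = \<iota> (c *\<^sub>C a) * lam g"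
        by (simp add: mult_scaleC_left clinear_scaleC[OF embedding_clinear])
      ultimately show "\<exists>a' g'. c *\<^sub>C (\<iota> a * lam g) = \<iota> a' * lam g' \<and> g' \<in> carrier G"
        by blast
    qed
    ultimately show "c *\<^sub>C x \<in> ?V"
      by (intro stable[OF bounded_linear_scaleC])
  next
    fix x assume "x \<in> ?V"
    then show "star x \<in> ?V"
      by (intro stable[OF bounded_linear_star]) (auto intro: star_monomial_mem)
  qed (use V in \<open>auto simp: subspace_0\<close>)
  moreover have "range \<iota> \<union> lam ` carrier G \<subseteq> ?V"
  proof -
    have "\<iota> a \<in> monomials" for a
      using monomialsI[of \<one> a] by (simp add: lam_one)
    moreover have "lam g \<in> monomials" if "g \<in> carrier G" for g
      using monomialsI[OF that, of 1] by (simp add: embedding_one)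
    ultimately show ?thesis
      using sub by blast
  qed
  ultimately have "cstar_subalgebra hull (range \<iota> \<union> lam ` carrier G) \<subseteq> ?V"
    by (intro hull_minimal)
  then show ?thesis
    using generated by auto
qed

lemma eq_on_monomials_imp_eq:
  fixes f h :: "'b \<Rightarrow> complex"
  assumes "bounded_linear f" "bounded_linear h"
    and "\<And>x. x \<in> monomials \<Longrightarrow> f x = h x"
  shows "f x = h x"
proof -
  have "closed {x. f x = h x}"
    using assms by (intro closed_Collect_eq linear_continuous_on)
  moreover have "span monomials \<subseteq> {x. f x = h x}"
    using linear_eq_on_span[of f h monomials] assms bounded_linear.linear by blast
  ultimately have "closure (span monomials) \<subseteq> {x. f x = h x}"
    by (intro closure_minimal)
  then show ?thesis
    using closure_span_monomials by auto
qed

section \<open>From invariant tracial states to tracial states of the crossed product\<close>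

text \<open>The cocycle identity for the triple \<open>g\<close>, \<open>inv g\<close>,
  \<open>g\<close>; its other two factors are normalized to 1.\<close>

lemma action_cocycle_inv:
  assumes g: "g \<in> carrier G"
  shows "\<alpha> g (\<sigma> (inv g) g) = \<sigma> g (inv g)"
  using cocycle[of g "inv g" g] g by (simp add: normalized)

lemma action_inv:
  assumes g: "g \<in> carrier G"
  shows "\<alpha> g (\<alpha> (inv g) a) = \<sigma> g (inv g) * a * star (\<sigma> g (inv g))"
proof -
  \<comment> \<open>\<open>\<alpha> \<one>\<close> is the identity: covariance with
    \<open>lam \<one> = 1\<close> shows it after applying \<open>\<iota>\<close>, and
    \<open>E\<close> is a left inverse of \<open>\<iota>\<close>.\<close>
  have "\<iota> (\<alpha> \<one> a) = \<iota> a"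
    using covariant[of \<one> a] by (simp add: lam_one)
  then have "\<alpha> \<one> a = a"
    by (metis expectation_embedding)
  then show ?thesis
    using twisted_action[of g "inv g" a] g by simp
qed

text \<open>\<open>g \<otimes> h\<close> and \<open>h \<otimes> g\<close> are trivial together. If
  they are not, \<open>E\<close> kills both products; otherwise \<open>h = inv g\<close>, and
  invariance and the trace property of \<open>\<phi>\<close> match the two coefficients.\<close>

lemma trace_expectation_monomials:
  assumes \<phi>: "invariant_tracial_state G \<alpha> \<phi>"
    and g: "g \<in> carrier G" and h: "h \<in> carrier G"
  shows "\<phi> (E ((\<iota> a * lam g) * (\<iota> b * lam h))) = \<phi> (E ((\<iota> b * lam h) * (\<iota> a * lam g)))"
proof (cases "g \<otimes> h = \<one>")
  case False
  then have "h \<otimes> g \<noteq> \<one>"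
    using g h inv_comm by blast
  then show ?thesis
    using False g h by (simp add: monomial_mult expectation_left expectation_lam)
next
  case True
  have tr: "\<phi> (x * y) = \<phi> (y * x)" and inv: "\<phi> (\<alpha> g x) = \<phi> x" for x y
    using \<phi> g by (auto simp: invariant_tracial_state_def tracial_state_def)
  have h_eq: "h = inv g"
    using True g h by (metis inv_equality inv_comm)
  have hom: "\<alpha> g (x * y) = \<alpha> g x * \<alpha> g y" for x y
    using aut[OF g] by (simp add: star_aut_def star_hom_def)
  let ?s = "\<sigma> g (inv g)"
  have u: "star ?s * ?s = 1"
    using g by (simp add: unitaries_star_mult unitary_cocycle)
  have "\<phi> (E ((\<iota> b * lam h) * (\<iota> a * lam g))) = \<phi> (b * \<alpha> (inv g) a * \<sigma> (inv g) g)"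
    using g h by (simp add: h_eq monomial_mult expectation_left lam_one expectation_embedding)
  \<comment> \<open>Inserting \<open>\<alpha> g\<close> undoes \<open>\<alpha> (inv g)\<close> up to
    conjugation by \<open>?s\<close> and turns \<open>\<sigma> (inv g) g\<close> into
    \<open>?s\<close>, so that \<open>star ?s * ?s\<close> cancels.\<close>
  also have "\<dots> = \<phi> (\<alpha> g (b * \<alpha> (inv g) a * \<sigma> (inv g) g))"
    by (simp add: inv)
  also have "\<dots> = \<phi> (\<alpha> g b * (?s * a * star ?s) * ?s)"
    by (simp only: hom action_inv[OF g] action_cocycle_inv[OF g])
  also have "\<dots> = \<phi> (\<alpha> g b * ?s * a)"
    by (simp add: mult.assoc u)
  also have "\<dots> = \<phi> (a * \<alpha> g b * ?s)"
    using tr[of "\<alpha> g b * ?s" a] by (simp add: mult.assoc)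
  also have "\<dots> = \<phi> (E ((\<iota> a * lam g) * (\<iota> b * lam h)))"
    using g h by (simp add: h_eq monomial_mult expectation_left lam_one expectation_embedding)
  finally show ?thesis ..
qed

lemma tracial_state_expectation:
  assumes \<phi>: "invariant_tracial_state G \<alpha> \<phi>"
  shows "tracial_state (\<phi> \<circ> E)"
proof -
  have "state \<phi>"
    using \<phi> by (simp add: invariant_tracial_state_def tracial_state_def)
  then have st: "state (\<phi> \<circ> E)"
    by (rule state_compose[where j = \<iota>])
      (simp_all add: expectation_clinear expectation_positive norm_expectation_le
        expectation_embedding embedding(2))
  have bl: "bounded_linear (\<lambda>x. (\<phi> \<circ> E) (x * y))" "bounded_linear (\<lambda>x. (\<phi> \<circ> E) (y * x))" for y
    by (rule bounded_linear_compose[OF stateD(2)[OF st] bounded_linear_mult_left],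
        rule bounded_linear_compose[OF stateD(2)[OF st] bounded_linear_mult_right])
  \<comment> \<open>Density is used twice: here for \<open>y\<close> with \<open>x\<close> a
    monomial, then for \<open>x\<close> with \<open>y\<close> arbitrary.\<close>
  have "(\<phi> \<circ> E) (x * y) = (\<phi> \<circ> E) (y * x)" if "x \<in> monomials" for x y
  proof (rule eq_on_monomials_imp_eq[OF bl(2)[of x] bl(1)[of x]])
    fix y assume "y \<in> monomials"
    then show "(\<phi> \<circ> E) (x * y) = (\<phi> \<circ> E) (y * x)"
      using that trace_expectation_monomials[OF \<phi>] by (auto simp: monomials_def)
  qed
  then have "(\<phi> \<circ> E) (x * y) = (\<phi> \<circ> E) (y * x)" for x y
    by (rule eq_on_monomials_imp_eq[OF bl[of y]])
  then show ?thesis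
    using st by (simp add: tracial_state_def)
qed

section \<open>From tracial states of the crossed product to invariant ones\<close>

lemma tracial_state_factors:
  assumes DP: "property_DP E" and \<psi>: "tracial_state \<psi>"
  shows "\<psi> (\<iota> (E x)) = \<psi> x"
proof -
  have st: "state \<psi>"
    using \<psi> by (simp add: tracial_state_def)
  have lin: "linear \<psi>"
    by (rule clinear_linear[OF stateD(1)[OF st]])
  have zero: "\<psi> y = 0" if y: "star y = y" "E y = 0" for y
  proof -
    \<comment> \<open>The level set of \<open>\<psi>\<close> through \<open>y\<close> is closed and
      convex and contains all unitary conjugates of \<open>y\<close>, so by (DP) it contains
      0.\<close>
    have "convex (\<psi> -` {\<psi> y})"
      by (intro convex_linear_vimage lin convex_singleton)
    then have "convex hull {v * y * star v | v. v \<in> unitaries} \<subseteq> \<psi> -` {\<psi> y}"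
      by (intro hull_minimal) (auto simp: tracial_state_unitary_conj[OF \<psi>])
    moreover have "closed (\<psi> -` {\<psi> y})"
      by (intro closed_vimage linear_continuous_on stateD(2)[OF st] closed_singleton)
    ultimately have "closure (convex hull {v * y * star v | v. v \<in> unitaries}) \<subseteq> \<psi> -` {\<psi> y}"
      by (rule closure_minimal)
    moreover have "0 \<in> closure (convex hull {v * y * star v | v. v \<in> unitaries})"
      using DP y by (simp add: property_DP_def)
    ultimately show ?thesis
      using linear_0[OF lin] by auto
  qed
  have sa: "\<psi> (\<iota> (E h)) = \<psi> h" if h: "star h = h" for h
  proof -
    \<comment> \<open>(DP) speaks of selfadjoint elements only, so \<open>h - \<iota> (E h)\<close>
      must be shown selfadjoint.\<close>
    have "star (E h) = E h"
      using positive_map_star[OF expectation_clinear expectation_positive, of h] h by simp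
    then have "star (h - \<iota> (E h)) = h - \<iota> (E h)"
      using h by (simp add: star_diff flip: embedding_star)
    moreover have "E (h - \<iota> (E h)) = 0"
      by (simp add: linear_diff[OF clinear_linear[OF expectation_clinear]] expectation_embedding)
    ultimately have "\<psi> (h - \<iota> (E h)) = 0"
      by (rule zero)
    then show ?thesis
      by (simp add: linear_diff[OF lin])
  qed
  obtain h k where "star h = h" "star k = k" "x = h + \<i> *\<^sub>C k"
    by (rule selfadjoint_decomposition)
  then show ?thesis
    by (simp add: sa clinear_add[OF expectation_clinear] clinear_scaleC[OF expectation_clinear]
        clinear_add[OF embedding_clinear] clinear_scaleC[OF embedding_clinear]
        clinear_add[OF stateD(1)[OF st]] clinear_scaleC[OF stateD(1)[OF st]])
qed

lemma invariant_tracial_state_restrict: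
  assumes DP: "property_DP E" and \<psi>: "tracial_state \<psi>"
  shows "invariant_tracial_state G \<alpha> (\<psi> \<circ> \<iota>)"
proof -
  have "state \<psi>"
    using \<psi> by (simp add: tracial_state_def)
  then have "state (\<psi> \<circ> \<iota>)"
    \<comment> \<open>Here \<open>E\<close> is the section:
      \<open>\<psi> (\<iota> (E x)) = \<psi> x\<close> keeps the norm of
      \<open>\<psi> \<circ> \<iota>\<close> equal to one.\<close>
    by (rule state_compose[where j = E])
      (simp_all add: embedding_clinear star_hom_positive[OF embedding(1)] embedding(2)
        tracial_state_factors[OF DP \<psi>] norm_expectation_le)
  \<comment> \<open>Invariance: \<open>\<iota>\<close> carries \<open>\<alpha> g\<close> to
    conjugation by \<open>lam g\<close>, which a trace does not see.\<close>
  then show ?thesis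
    using \<psi> tracial_state_unitary_conj[OF \<psi> lam_unitary]
    by (simp add: invariant_tracial_state_def tracial_state_def embedding_mult covariant)
qed

text \<open>The inverse is restriction along \<open>\<iota>\<close>; the two composites are
  identities by \<open>E (\<iota> a) = a\<close> and by
  \<open>tracial_state_factors\<close>.\<close>

lemma bij_betw_tracial_states:
  assumes DP: "property_DP E"
  shows "bij_betw (\<lambda>\<phi>. \<phi> \<circ> E) {\<phi>. invariant_tracial_state G \<alpha> \<phi>} {\<psi>. tracial_state \<psi>}"
proof (rule bij_betwI[where g = "\<lambda>\<psi>. \<psi> \<circ> \<iota>"])
  show "(\<lambda>\<phi>. \<phi> \<circ> E) \<in> {\<phi>. invariant_tracial_state G \<alpha> \<phi>} \<rightarrow> {\<psi>. tracial_state \<psi>}"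
    by (simp add: tracial_state_expectation)
  show "(\<lambda>\<psi>. \<psi> \<circ> \<iota>) \<in> {\<psi>. tracial_state \<psi>} \<rightarrow> {\<phi>. invariant_tracial_state G \<alpha> \<phi>}"
    by (simp add: invariant_tracial_state_restrict[OF DP])
  show "\<phi> \<circ> E \<circ> \<iota> = \<phi>" for \<phi> :: "'a \<Rightarrow> complex"
    by (rule ext) (simp add: expectation_embedding)
  show "\<psi> \<circ> \<iota> \<circ> E = \<psi>" if "\<psi> \<in> {\<psi>. tracial_state \<psi>}" for \<psi>
    using that by (intro ext) (simp add: tracial_state_factors[OF DP])
qed

end

text \<open>Unique existence says that the set is a singleton, and a bijection and its inverse map
  singletons to singletons.\<close>

lemma bij_betw_ex1_iff:
  assumes f: "bij_betw f {x. P x} {y. Q y}"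
  shows "(\<exists>!y. Q y) \<longleftrightarrow> (\<exists>!x. P x)"
proof
  assume "\<exists>!y. Q y"
  then obtain b where "{y. Q y} = {b}"
    by blast
  then have "{x. P x} = {the_inv_into {x. P x} f b}"
    using bij_betw_imp_surj_on[OF bij_betw_the_inv_into[OF f]] by simp
  then show "\<exists>!x. P x"
    by (simp add: set_eq_iff)
next
  assume "\<exists>!x. P x"
  then obtain a where "{x. P x} = {a}"
    by blast
  then have "{y. Q y} = {f a}"
    using bij_betw_imp_surj_on[OF f] by simp
  then show "\<exists>!y. Q y"
    by (simp add: set_eq_iff)
qed

theorem proposition3p4:
  fixes G :: "('g, 'm) monoid_scheme"
    and \<alpha> :: "'g \<Rightarrow> 'a::unital_cstar_algebra \<Rightarrow> 'a"
    and \<sigma> :: "'g \<Rightarrow> 'g \<Rightarrow> 'a"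
    and \<iota> :: "'a \<Rightarrow> 'b::unital_cstar_algebra"
    and lam :: "'g \<Rightarrow> 'b"
    and E :: "'b \<Rightarrow> 'a"
  assumes "reduced_crossed_product G \<alpha> \<sigma> \<iota> lam E"
    and "property_DP E"
  shows "bij_betw (\<lambda>\<phi>. \<phi> \<circ> E)
           {\<phi> :: 'a \<Rightarrow> complex. invariant_tracial_state G \<alpha> \<phi>}
           {\<psi> :: 'b \<Rightarrow> complex. tracial_state \<psi>}
       \<and> ((\<exists>!\<psi> :: 'b \<Rightarrow> complex. tracial_state \<psi>) \<longleftrightarrow>
          (\<exists>!\<phi> :: 'a \<Rightarrow> complex. invariant_tracial_state G \<alpha> \<phi>))"
  using reduced_crossed_product.bij_betw_tracial_states[OF assms]
  by (intro conjI bij_betw_ex1_iff)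

end
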